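(* Let $R$ be a ring and let $M$ be a left $R$-module that is projective in $\sigma[M]$. Then the topological space $\mathrm{Spec}(M)$ is sober.
   Context: Rings are associative with identity, not necessarily commutative; modules are unital left modules. $\sigma[M]$ is the full subcategory of $R$-modules consisting of all modules that embed in an $M$-generated module (a quotient of a direct sum of copies of $M$). $M$ is projective in $\sigma[M]$ if for every epimorphism $X\to Y$ in $\sigma[M]$ the induced map $\mathrm{Hom}_R(M,X)\to\mathrm{Hom}_R(M,Y)$ is surjective. A submodule $N\leq M$ is fully invariant if $f(N)\subseteq N$ for all $f\in\mathrm{End}_R(M)$; $\Lambda^{fi}(M)$ is the set of fully invariant submodules. For $N\leq M$ and a module $K$, $N_MK=\sum\{f(N)\mid f\in\mathrm{Hom}_R(M,K)\}$. A proper fully invariant submodule $P$ of $M$ is prime in $M$ if $L_MK\leq P$ with $L,K\in\Lambda^{fi}(M)$ implies $L\leq P$ or $K\leq P$. $\mathrm{Spec}(M)$ is the set of prime submodules of $M$, with the topology whose open sets are $\mathcal{U}(N)=\{P\in\mathrm{Spec}(M)\mid N\nleq P\}$ for $N\in\Lambda^{fi}(M)$. A nonempty closed subset $X$ of a space $S$ is closed irreducible if for all open $U,V$, $X\cap U\neq\emptyset$ and $X\cap V\neq\emptyset$ imply $X\cap U\cap V\neq\emptyset$. A space is sober if every closed irreducible subset is the closure of a unique point. *)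

theory Defs
  imports "HOL-Algebra.Module" "HOL-Analysis.Abstract_Topology"
begin

section \<open>Left modules over a ring that need not be commutative\<close>

text \<open>The library locale \<open>module\<close> of HOL-Algebra fixes a commutative base ring. The record
  \<open>module\<close> and the locale \<open>submodule\<close> do not depend on this and are used as they are; the fields
  \<open>mult\<close> and \<open>one\<close> of a module record carry no information.\<close>

locale left_module = R?: ring R + M?: abelian_group M
  for R :: "('r, 'e) ring_scheme" (structure) and M :: "('r, 'm, 'c) module_scheme" (structure) +
  assumes smult_closed [simp, intro]:
      "\<lbrakk>a \<in> carrier R; x \<in> carrier M\<rbrakk> \<Longrightarrow> a \<odot>\<^bsub>M\<^esub> x \<in> carrier M"
    and smult_l_distr:
      "\<lbrakk>a \<in> carrier R; b \<in> carrier R; x \<in> carrier M\<rbrakk> \<Longrightarrow>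
        (a \<oplus>\<^bsub>R\<^esub> b) \<odot>\<^bsub>M\<^esub> x = a \<odot>\<^bsub>M\<^esub> x \<oplus>\<^bsub>M\<^esub> b \<odot>\<^bsub>M\<^esub> x"
    and smult_r_distr:
      "\<lbrakk>a \<in> carrier R; x \<in> carrier M; y \<in> carrier M\<rbrakk> \<Longrightarrow>
        a \<odot>\<^bsub>M\<^esub> (x \<oplus>\<^bsub>M\<^esub> y) = a \<odot>\<^bsub>M\<^esub> x \<oplus>\<^bsub>M\<^esub> a \<odot>\<^bsub>M\<^esub> y"
    and smult_assoc1:
      "\<lbrakk>a \<in> carrier R; b \<in> carrier R; x \<in> carrier M\<rbrakk> \<Longrightarrow>
        (a \<otimes>\<^bsub>R\<^esub> b) \<odot>\<^bsub>M\<^esub> x = a \<odot>\<^bsub>M\<^esub> (b \<odot>\<^bsub>M\<^esub> x)"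
    and smult_one [simp]: "x \<in> carrier M \<Longrightarrow> \<one>\<^bsub>R\<^esub> \<odot>\<^bsub>M\<^esub> x = x"

definition lmod_hom ::
    "('r, 'e) ring_scheme \<Rightarrow> ('r, 'm, 'c) module_scheme \<Rightarrow> ('r, 'n, 'd) module_scheme \<Rightarrow> ('m \<Rightarrow> 'n) set"
  where "lmod_hom R M N =
    {f \<in> carrier M \<rightarrow> carrier N.
      (\<forall>x\<in>carrier M. \<forall>y\<in>carrier M. f (x \<oplus>\<^bsub>M\<^esub> y) = f x \<oplus>\<^bsub>N\<^esub> f y) \<and>
      (\<forall>a\<in>carrier R. \<forall>x\<in>carrier M. f (a \<odot>\<^bsub>M\<^esub> x) = a \<odot>\<^bsub>N\<^esub> f x)}"

text \<open>The direct sum of copies of \<open>M\<close> indexed by \<open>I\<close>.\<close>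

definition copower :: "('r, 'm, 'c) module_scheme \<Rightarrow> 'i set \<Rightarrow> ('r, 'i \<Rightarrow> 'm) module"
  where "copower M I =
    \<lparr>carrier = {x \<in> I \<rightarrow>\<^sub>E carrier M. finite {i \<in> I. x i \<noteq> \<zero>\<^bsub>M\<^esub>}},
     mult = undefined, one = undefined,
     zero = (\<lambda>i\<in>I. \<zero>\<^bsub>M\<^esub>), add = (\<lambda>x y. \<lambda>i\<in>I. x i \<oplus>\<^bsub>M\<^esub> y i),
     smult = (\<lambda>a x. \<lambda>i\<in>I. a \<odot>\<^bsub>M\<^esub> x i)\<rparr>"


section \<open>The category \<open>\<sigma>[M]\<close> and projectivity in it\<close>

text \<open>A definition cannot quantify over types, so index sets and auxiliary modules range over
  fixed types below. These types are large enough: \<open>M_generatedI\<close>, \<open>in_sigmaI\<close> and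
  \<open>projective_in_sigma_lift\<close> show that each notion agrees with the one in which the index
  sets and modules live in arbitrary types.\<close>

definition M_generated ::
    "('r, 'e) ring_scheme \<Rightarrow> ('r, 'm, 'c) module_scheme \<Rightarrow> ('r, 'n, 'd) module_scheme \<Rightarrow> bool"
  where "M_generated R M N \<longleftrightarrow> left_module R N \<and>
    (\<exists>(I :: ('n \<times> nat) set). \<exists>h \<in> lmod_hom R (copower M I) N.
      h ` carrier (copower M I) = carrier N)"

definition in_sigma ::
    "('r, 'e) ring_scheme \<Rightarrow> ('r, 'm, 'c) module_scheme \<Rightarrow> ('r, 'x, 'd) module_scheme \<Rightarrow> bool"
  where "in_sigma R M X \<longleftrightarrow> left_module R X \<and>
    (\<exists>(N :: ('r, ('x \<times> nat \<Rightarrow> 'm) set) module). M_generated R M N \<and>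
      (\<exists>e \<in> lmod_hom R X N. inj_on e (carrier X)))"

text \<open>Epimorphisms of \<open>\<sigma>[M]\<close> are the surjective homomorphisms, as \<open>\<sigma>[M]\<close> is a full
  subcategory closed under quotients.\<close>

definition projective_in_sigma ::
    "('r, 'e) ring_scheme \<Rightarrow> ('r, 'm, 'c) module_scheme \<Rightarrow> bool"
  where "projective_in_sigma R M \<longleftrightarrow>
    (\<forall>(X :: ('r, ('m \<times> nat \<Rightarrow> 'm) set) module) (Y :: ('r, ('m \<times> nat \<Rightarrow> 'm) set) module).
      in_sigma R M X \<longrightarrow> in_sigma R M Y \<longrightarrow>
      (\<forall>g \<in> lmod_hom R X Y. g ` carrier X = carrier Y \<longrightarrow>
        (\<forall>f \<in> lmod_hom R M Y. \<exists>h \<in> lmod_hom R M X. \<forall>m \<in> carrier M. g (h m) = f m)))"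


section \<open>Products of submodules and the space \<open>Spec(M)\<close>\<close>

definition fully_invariant ::
    "('r, 'e) ring_scheme \<Rightarrow> ('r, 'm, 'c) module_scheme \<Rightarrow> 'm set set"
  where "fully_invariant R M =
    {N. submodule N R M \<and> (\<forall>f \<in> lmod_hom R M M. f ` N \<subseteq> N)}"

definition submodule_sum :: "('r, 'm, 'c) module_scheme \<Rightarrow> 'm set set \<Rightarrow> 'm set"
  where "submodule_sum M F =
    {finsum M x A | x A. finite A \<and> A \<subseteq> F \<and> (\<forall>S\<in>A. x S \<in> S)}"

text \<open>\<open>module_prod R M N K\<close> is the product usually written \<open>N\<^sub>M K\<close>.\<close>

definition module_prod ::
    "('r, 'e) ring_scheme \<Rightarrow> ('r, 'm, 'c) module_scheme \<Rightarrow> 'm set \<Rightarrow> ('r, 'k, 'd) module_scheme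
      \<Rightarrow> 'k set"
  where "module_prod R M N K = submodule_sum K {f ` N | f. f \<in> lmod_hom R M K}"

definition Spec :: "('r, 'e) ring_scheme \<Rightarrow> ('r, 'm, 'c) module_scheme \<Rightarrow> 'm set set"
  where "Spec R M =
    {P \<in> fully_invariant R M. P \<noteq> carrier M \<and>
      (\<forall>L \<in> fully_invariant R M. \<forall>K \<in> fully_invariant R M.
        module_prod R M L (M\<lparr>carrier := K\<rparr>) \<subseteq> P \<longrightarrow> L \<subseteq> P \<or> K \<subseteq> P)}"

definition Spec_open ::
    "('r, 'e) ring_scheme \<Rightarrow> ('r, 'm, 'c) module_scheme \<Rightarrow> 'm set \<Rightarrow> 'm set set"
  where "Spec_open R M N = {P \<in> Spec R M. \<not> N \<subseteq> P}"

text \<open>The argument of \<open>topology\<close> is a topology, see \<open>istopology_Spec\<close>.\<close>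

definition Spec_topology ::
    "('r, 'e) ring_scheme \<Rightarrow> ('r, 'm, 'c) module_scheme \<Rightarrow> 'm set topology"
  where "Spec_topology R M = topology (\<lambda>W. \<exists>N \<in> fully_invariant R M. W = Spec_open R M N)"


section \<open>Sober spaces\<close>

definition closed_irreducible :: "'a topology \<Rightarrow> 'a set \<Rightarrow> bool"
  where "closed_irreducible T X \<longleftrightarrow> closedin T X \<and> X \<noteq> {} \<and>
    (\<forall>U V. openin T U \<longrightarrow> openin T V \<longrightarrow> X \<inter> U \<noteq> {} \<longrightarrow> X \<inter> V \<noteq> {} \<longrightarrow> X \<inter> U \<inter> V \<noteq> {})"

definition sober_space :: "'a topology \<Rightarrow> bool"
  where "sober_space T \<longleftrightarrow>
    (\<forall>X. closed_irreducible T X \<longrightarrow> (\<exists>!x. x \<in> topspace T \<and> X = Abstract_Topology.closure_of T {x}))"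


section \<open>Homomorphisms and submodules\<close>

lemma lmod_homI:
  assumes "\<And>x. x \<in> carrier M \<Longrightarrow> f x \<in> carrier N"
    and "\<And>x y. \<lbrakk>x \<in> carrier M; y \<in> carrier M\<rbrakk> \<Longrightarrow> f (x \<oplus>\<^bsub>M\<^esub> y) = f x \<oplus>\<^bsub>N\<^esub> f y"
    and "\<And>a x. \<lbrakk>a \<in> carrier R; x \<in> carrier M\<rbrakk> \<Longrightarrow> f (a \<odot>\<^bsub>M\<^esub> x) = a \<odot>\<^bsub>N\<^esub> f x"
  shows "f \<in> lmod_hom R M N"
  using assms by (auto simp: lmod_hom_def)

lemma lmod_homD:
  assumes "f \<in> lmod_hom R M N"
  shows "x \<in> carrier M \<Longrightarrow> f x \<in> carrier N"
    and "\<lbrakk>x \<in> carrier M; y \<in> carrier M\<rbrakk> \<Longrightarrow> f (x \<oplus>\<^bsub>M\<^esub> y) = f x \<oplus>\<^bsub>N\<^esub> f y"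
    and "\<lbrakk>a \<in> carrier R; x \<in> carrier M\<rbrakk> \<Longrightarrow> f (a \<odot>\<^bsub>M\<^esub> x) = a \<odot>\<^bsub>N\<^esub> f x"
  using assms by (auto simp: lmod_hom_def)

lemma lmod_hom_comp:
  assumes "f \<in> lmod_hom R M N" "g \<in> lmod_hom R N K"
  shows "(\<lambda>x. g (f x)) \<in> lmod_hom R M K"
  using lmod_homD[OF assms(1)] lmod_homD[OF assms(2)] by (intro lmod_homI) auto

context left_module
begin

lemma add_idem_zero:
  assumes "x \<in> carrier M" "x \<oplus>\<^bsub>M\<^esub> x = x"
  shows "x = \<zero>\<^bsub>M\<^esub>"
  using assms M.add.l_cancel_one by blast

lemma smult_r_null [simp]:
  assumes "a \<in> carrier R"
  shows "a \<odot>\<^bsub>M\<^esub> \<zero>\<^bsub>M\<^esub> = \<zero>\<^bsub>M\<^esub>"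
  using smult_r_distr[OF assms, of "\<zero>\<^bsub>M\<^esub>" "\<zero>\<^bsub>M\<^esub>"] assms by (intro add_idem_zero) auto

lemma smult_l_null [simp]:
  assumes "x \<in> carrier M"
  shows "\<zero>\<^bsub>R\<^esub> \<odot>\<^bsub>M\<^esub> x = \<zero>\<^bsub>M\<^esub>"
  using smult_l_distr[of "\<zero>\<^bsub>R\<^esub>" "\<zero>\<^bsub>R\<^esub>" x] assms by (intro add_idem_zero) auto

lemma minus_eq_smult:
  assumes "x \<in> carrier M"
  shows "\<ominus>\<^bsub>M\<^esub> x = (\<ominus>\<^bsub>R\<^esub> \<one>\<^bsub>R\<^esub>) \<odot>\<^bsub>M\<^esub> x"
proof -
  have "(\<ominus>\<^bsub>R\<^esub> \<one>\<^bsub>R\<^esub>) \<odot>\<^bsub>M\<^esub> x \<oplus>\<^bsub>M\<^esub> x = (\<ominus>\<^bsub>R\<^esub> \<one>\<^bsub>R\<^esub>) \<odot>\<^bsub>M\<^esub> x \<oplus>\<^bsub>M\<^esub> \<one>\<^bsub>R\<^esub> \<odot>\<^bsub>M\<^esub> x"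
    using assms by simp
  also have "\<dots> = \<zero>\<^bsub>M\<^esub>"
    using assms smult_l_distr[of "\<ominus>\<^bsub>R\<^esub> \<one>\<^bsub>R\<^esub>" "\<one>\<^bsub>R\<^esub>" x] by (simp add: R.l_neg)
  finally show ?thesis
    using assms by (intro M.minus_equality) auto
qed

lemma submoduleI:
  assumes "H \<subseteq> carrier M" "\<zero>\<^bsub>M\<^esub> \<in> H"
    and "\<And>x y. \<lbrakk>x \<in> H; y \<in> H\<rbrakk> \<Longrightarrow> x \<oplus>\<^bsub>M\<^esub> y \<in> H"
    and smult: "\<And>a x. \<lbrakk>a \<in> carrier R; x \<in> H\<rbrakk> \<Longrightarrow> a \<odot>\<^bsub>M\<^esub> x \<in> H"
  shows "submodule H R M"
proof -
  have "\<ominus>\<^bsub>M\<^esub> x \<in> H" if "x \<in> H" for x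
    using that assms(1) smult[of "\<ominus>\<^bsub>R\<^esub> \<one>\<^bsub>R\<^esub>" x] minus_eq_smult[of x] by auto
  then show ?thesis
    using assms unfolding submodule_def submodule_axioms_def subgroup_def
    by (auto simp: a_inv_def)
qed

lemma submoduleD:
  assumes "submodule H R M"
  shows "H \<subseteq> carrier M" "\<zero>\<^bsub>M\<^esub> \<in> H"
    and "\<And>x y. \<lbrakk>x \<in> H; y \<in> H\<rbrakk> \<Longrightarrow> x \<oplus>\<^bsub>M\<^esub> y \<in> H"
    and "\<And>a x. \<lbrakk>a \<in> carrier R; x \<in> H\<rbrakk> \<Longrightarrow> a \<odot>\<^bsub>M\<^esub> x \<in> H"
  using assms unfolding submodule_def submodule_axioms_def subgroup_def by auto

end

lemma left_moduleI:
  assumes "ring R"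
    and "\<And>x y. \<lbrakk>x \<in> carrier M; y \<in> carrier M\<rbrakk> \<Longrightarrow> x \<oplus>\<^bsub>M\<^esub> y \<in> carrier M"
    and "\<zero>\<^bsub>M\<^esub> \<in> carrier M"
    and "\<And>x y z. \<lbrakk>x \<in> carrier M; y \<in> carrier M; z \<in> carrier M\<rbrakk>
          \<Longrightarrow> (x \<oplus>\<^bsub>M\<^esub> y) \<oplus>\<^bsub>M\<^esub> z = x \<oplus>\<^bsub>M\<^esub> (y \<oplus>\<^bsub>M\<^esub> z)"
    and "\<And>x y. \<lbrakk>x \<in> carrier M; y \<in> carrier M\<rbrakk> \<Longrightarrow> x \<oplus>\<^bsub>M\<^esub> y = y \<oplus>\<^bsub>M\<^esub> x"
    and "\<And>x. x \<in> carrier M \<Longrightarrow> \<zero>\<^bsub>M\<^esub> \<oplus>\<^bsub>M\<^esub> x = x"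
    and "\<And>x. x \<in> carrier M \<Longrightarrow> \<exists>y\<in>carrier M. y \<oplus>\<^bsub>M\<^esub> x = \<zero>\<^bsub>M\<^esub>"
    and "\<And>a x. \<lbrakk>a \<in> carrier R; x \<in> carrier M\<rbrakk> \<Longrightarrow> a \<odot>\<^bsub>M\<^esub> x \<in> carrier M"
    and "\<And>a b x. \<lbrakk>a \<in> carrier R; b \<in> carrier R; x \<in> carrier M\<rbrakk>
          \<Longrightarrow> (a \<oplus>\<^bsub>R\<^esub> b) \<odot>\<^bsub>M\<^esub> x = a \<odot>\<^bsub>M\<^esub> x \<oplus>\<^bsub>M\<^esub> b \<odot>\<^bsub>M\<^esub> x"
    and "\<And>a x y. \<lbrakk>a \<in> carrier R; x \<in> carrier M; y \<in> carrier M\<rbrakk>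
          \<Longrightarrow> a \<odot>\<^bsub>M\<^esub> (x \<oplus>\<^bsub>M\<^esub> y) = a \<odot>\<^bsub>M\<^esub> x \<oplus>\<^bsub>M\<^esub> a \<odot>\<^bsub>M\<^esub> y"
    and "\<And>a b x. \<lbrakk>a \<in> carrier R; b \<in> carrier R; x \<in> carrier M\<rbrakk>
          \<Longrightarrow> (a \<otimes>\<^bsub>R\<^esub> b) \<odot>\<^bsub>M\<^esub> x = a \<odot>\<^bsub>M\<^esub> (b \<odot>\<^bsub>M\<^esub> x)"
    and "\<And>x. x \<in> carrier M \<Longrightarrow> \<one>\<^bsub>R\<^esub> \<odot>\<^bsub>M\<^esub> x = x"
  shows "left_module R M"
  by (intro left_module.intro left_module_axioms.intro assms abelian_groupI)

lemma left_module_submodule: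
  assumes "left_module R M" "submodule H R M"
  shows "left_module R (M\<lparr>carrier := H\<rparr>)"
proof -
  interpret left_module R M by fact
  note H = submoduleD[OF assms(2)]
  have sub: "\<And>x. x \<in> H \<Longrightarrow> x \<in> carrier M"
    using H(1) by auto
  have inv: "\<exists>y\<in>H. y \<oplus>\<^bsub>M\<^esub> x = \<zero>\<^bsub>M\<^esub>" if "x \<in> H" for x
    using that sub[OF that] H(4)[of "\<ominus>\<^bsub>R\<^esub> \<one>\<^bsub>R\<^esub>" x] minus_eq_smult[of x] M.l_neg[of x]
    by (intro bexI[of _ "\<ominus>\<^bsub>M\<^esub> x"]) auto
  show ?thesis
    by (rule left_moduleI)
       (use sub inv H in \<open>auto simp: R.ring_axioms M.a_ac smult_l_distr smult_r_distr smult_assoc1\<close>)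
qed

lemma lmod_hom_zero:
  assumes "left_module R M" "left_module R N" "f \<in> lmod_hom R M N"
  shows "f \<zero>\<^bsub>M\<^esub> = \<zero>\<^bsub>N\<^esub>"
proof -
  interpret M: left_module R M by fact
  interpret N: left_module R N by fact
  have "f \<zero>\<^bsub>M\<^esub> \<oplus>\<^bsub>N\<^esub> f \<zero>\<^bsub>M\<^esub> = f \<zero>\<^bsub>M\<^esub>"
    using lmod_homD(2)[OF assms(3), of "\<zero>\<^bsub>M\<^esub>" "\<zero>\<^bsub>M\<^esub>"] by simp
  then show ?thesis
    using lmod_homD(1)[OF assms(3)] by (intro N.add_idem_zero) auto
qed

lemma left_module_copower:
  assumes "left_module R M"
  shows "left_module R (copower M I)"
proof -
  interpret left_module R M by fact
  have add: "finite {i \<in> I. x i \<oplus>\<^bsub>M\<^esub> y i \<noteq> \<zero>\<^bsub>M\<^esub>}"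
    if "finite {i \<in> I. x i \<noteq> \<zero>\<^bsub>M\<^esub>}" "finite {i \<in> I. y i \<noteq> \<zero>\<^bsub>M\<^esub>}" for x y
    by (rule finite_subset[OF _ finite_UnI[OF that]]) auto
  have smult: "finite {i \<in> I. a \<odot>\<^bsub>M\<^esub> x i \<noteq> \<zero>\<^bsub>M\<^esub>}"
    if "finite {i \<in> I. x i \<noteq> \<zero>\<^bsub>M\<^esub>}" "a \<in> carrier R" for a x
    by (rule finite_subset[OF _ that(1)]) (use that(2) in auto)
  have mem: "x i \<in> carrier M" if "x \<in> carrier (copower M I)" "i \<in> I" for x i
    using that by (auto simp: copower_def)
  have arb: "x i = undefined" if "x \<in> carrier (copower M I)" "i \<notin> I" for x i
    using that by (auto simp: copower_def)
  have comps: "(x \<oplus>\<^bsub>copower M I\<^esub> y) i = (if i \<in> I then x i \<oplus>\<^bsub>M\<^esub> y i else undefined)"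
    "(a \<odot>\<^bsub>copower M I\<^esub> x) i = (if i \<in> I then a \<odot>\<^bsub>M\<^esub> x i else undefined)"
    "\<zero>\<^bsub>copower M I\<^esub> i = (if i \<in> I then \<zero>\<^bsub>M\<^esub> else undefined)" for x y a i
    by (simp_all add: copower_def)
  have inv: "\<exists>y\<in>carrier (copower M I). y \<oplus>\<^bsub>copower M I\<^esub> x = \<zero>\<^bsub>copower M I\<^esub>"
    if x: "x \<in> carrier (copower M I)" for x
  proof (rule bexI)
    show "(\<lambda>i\<in>I. (\<ominus>\<^bsub>R\<^esub> \<one>\<^bsub>R\<^esub>) \<odot>\<^bsub>M\<^esub> x i) \<in> carrier (copower M I)"
      using x smult[of x "\<ominus>\<^bsub>R\<^esub> \<one>\<^bsub>R\<^esub>"] by (auto simp: copower_def cong: conj_cong)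
    have "(\<ominus>\<^bsub>R\<^esub> \<one>\<^bsub>R\<^esub>) \<odot>\<^bsub>M\<^esub> x i \<oplus>\<^bsub>M\<^esub> x i = \<zero>\<^bsub>M\<^esub>" if "i \<in> I" for i
    proof -
      have "x i \<in> carrier M" using x that by (auto simp: copower_def)
      then show ?thesis by (simp flip: minus_eq_smult add: M.l_neg)
    qed
    then show "(\<lambda>i\<in>I. (\<ominus>\<^bsub>R\<^esub> \<one>\<^bsub>R\<^esub>) \<odot>\<^bsub>M\<^esub> x i) \<oplus>\<^bsub>copower M I\<^esub> x = \<zero>\<^bsub>copower M I\<^esub>"
      by (auto simp: copower_def)
  qed
  show ?thesis
  proof (rule left_moduleI[OF R.ring_axioms])
    show "x \<oplus>\<^bsub>copower M I\<^esub> y \<in> carrier (copower M I)"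
      if "x \<in> carrier (copower M I)" "y \<in> carrier (copower M I)" for x y
      using that add[of x y] by (auto simp: copower_def PiE_mem cong: conj_cong)
    show "\<zero>\<^bsub>copower M I\<^esub> \<in> carrier (copower M I)"
      by (auto simp: copower_def cong: conj_cong)
    show "a \<odot>\<^bsub>copower M I\<^esub> x \<in> carrier (copower M I)"
      if "a \<in> carrier R" "x \<in> carrier (copower M I)" for a x
      using that smult[of x a] by (auto simp: copower_def PiE_mem cong: conj_cong)
    show "\<exists>y\<in>carrier (copower M I). y \<oplus>\<^bsub>copower M I\<^esub> x = \<zero>\<^bsub>copower M I\<^esub>"
      if "x \<in> carrier (copower M I)" for x
      using inv that .
  qed (simp_all add: fun_eq_iff comps mem arb M.a_ac
        smult_l_distr smult_r_distr smult_assoc1)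
qed

lemma submodule_image:
  assumes "left_module R M" "left_module R N" "f \<in> lmod_hom R M N"
  shows "submodule (f ` carrier M) R N"
proof -
  interpret M: left_module R M by fact
  interpret N: left_module R N by fact
  note f = lmod_homD[OF assms(3)]
  show ?thesis
  proof (rule N.submoduleI)
    show "\<zero>\<^bsub>N\<^esub> \<in> f ` carrier M"
      using lmod_hom_zero[OF assms] M.zero_closed by (metis imageI)
  qed (auto simp: f(1) simp flip: f(2,3))
qed


section \<open>Independence of the types chosen in the definition of \<open>\<sigma>[M]\<close>\<close>

lemma copower_reindex:
  fixes M :: "('r, 'm, 'c) module_scheme" and I :: "'i set" and B :: "'b set"
  assumes M: "left_module R M"
    and h: "h \<in> lmod_hom R (copower M I) N"
    and c: "\<And>b. b \<in> B \<Longrightarrow> c b \<in> h ` carrier (copower M I)"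
  obtains J :: "('b \<times> nat) set" and h' where "h' \<in> lmod_hom R (copower M J) N"
    "h' ` carrier (copower M J) \<subseteq> h ` carrier (copower M I)"
    "c ` B \<subseteq> h' ` carrier (copower M J)"
proof -
  interpret left_module R M by fact
  have "\<forall>b\<in>B. \<exists>s. s \<in> carrier (copower M I) \<and> h s = c b"
    using c by force
  then obtain s where s: "\<And>b. b \<in> B \<Longrightarrow> s b \<in> carrier (copower M I)"
      "\<And>b. b \<in> B \<Longrightarrow> h (s b) = c b"
    by metis
  define S where "S b = {i \<in> I. s b i \<noteq> \<zero>\<^bsub>M\<^esub>}" for b
  have "finite (S b)" if "b \<in> B" for b
    using s(1)[OF that] by (simp add: S_def copower_def)
  then have "\<forall>b\<in>B. \<exists>e :: 'i \<Rightarrow> nat. inj_on e (S b)"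
    using finite_imp_inj_to_nat_seg by metis
  then obtain e :: "'b \<Rightarrow> 'i \<Rightarrow> nat" where e: "\<And>b. b \<in> B \<Longrightarrow> inj_on (e b) (S b)"
    by metis
  define I' where "I' = (\<Union>b\<in>B. S b)"
  have I': "I' \<subseteq> I"
    by (auto simp: I'_def S_def)
  have "\<forall>i\<in>I'. \<exists>b. b \<in> B \<and> i \<in> S b"
    by (auto simp: I'_def)
  then obtain p where p: "\<And>i. i \<in> I' \<Longrightarrow> p i \<in> B" "\<And>i. i \<in> I' \<Longrightarrow> i \<in> S (p i)"
    by metis
  define \<iota> where "\<iota> i = (p i, e (p i) i)" for i
  have inj: "inj_on \<iota> I'"
    unfolding inj_on_def \<iota>_def using p e by (metis inj_onD prod.inject)
  define J where "J = \<iota> ` I'"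
  define ext where "ext t = (\<lambda>i\<in>I. if i \<in> I' then t (\<iota> i) else \<zero>\<^bsub>M\<^esub>)" for t :: "'b \<times> nat \<Rightarrow> 'm"
  have ext: "ext t \<in> carrier (copower M I)" if t: "t \<in> carrier (copower M J)" for t
  proof -
    have "finite {j \<in> J. t j \<noteq> \<zero>\<^bsub>M\<^esub>}"
      using t by (simp add: copower_def)
    moreover have "\<iota> ` {i \<in> I'. t (\<iota> i) \<noteq> \<zero>\<^bsub>M\<^esub>} \<subseteq> {j \<in> J. t j \<noteq> \<zero>\<^bsub>M\<^esub>}"
      by (auto simp: J_def)
    ultimately have "finite {i \<in> I'. t (\<iota> i) \<noteq> \<zero>\<^bsub>M\<^esub>}"
      by (intro finite_imageD[of \<iota>] finite_subset[of "\<iota> ` _"] inj_on_subset[OF inj]) auto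
    then have "finite {i \<in> I. ext t i \<noteq> \<zero>\<^bsub>M\<^esub>}"
      by (rule rev_finite_subset) (auto simp: ext_def)
    moreover have "t (\<iota> i) \<in> carrier M" if "i \<in> I'" for i
      using t that PiE_mem[of t J "\<lambda>_. carrier M" "\<iota> i"] by (simp add: copower_def J_def)
    then have "ext t \<in> I \<rightarrow>\<^sub>E carrier M"
      by (auto simp: ext_def)
    ultimately show ?thesis
      by (simp add: copower_def)
  qed
  have ext_add: "ext (t \<oplus>\<^bsub>copower M J\<^esub> u) = ext t \<oplus>\<^bsub>copower M I\<^esub> ext u" for t u
    by (auto simp: ext_def copower_def J_def fun_eq_iff)
  have ext_smult: "ext (a \<odot>\<^bsub>copower M J\<^esub> t) = a \<odot>\<^bsub>copower M I\<^esub> ext t" if "a \<in> carrier R" for a t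
    using that by (auto simp: ext_def copower_def J_def fun_eq_iff)
  note hD = lmod_homD[OF h]
  show ?thesis
  proof (rule that)
    show "(\<lambda>t. h (ext t)) \<in> lmod_hom R (copower M J) N"
      by (rule lmod_homI) (auto simp: ext ext_add ext_smult hD)
    show "(\<lambda>t. h (ext t)) ` carrier (copower M J) \<subseteq> h ` carrier (copower M I)"
      using ext by auto
    show "c ` B \<subseteq> (\<lambda>t. h (ext t)) ` carrier (copower M J)"
    proof (rule image_subsetI)
      fix b assume b: "b \<in> B"
      define t where "t = (\<lambda>j\<in>J. s b (inv_into I' \<iota> j))"
      have t_\<iota>: "t (\<iota> i) = s b i" if "i \<in> I'" for i
        using that inj by (simp add: t_def J_def)
      have "s b i \<in> carrier M" if "i \<in> I" for i
        using s(1)[OF b] that by (auto simp: copower_def)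
      then have "t \<in> J \<rightarrow>\<^sub>E carrier M"
        using I' t_\<iota> by (auto simp: J_def t_def)
      moreover have "finite {j \<in> J. t j \<noteq> \<zero>\<^bsub>M\<^esub>}"
      proof (rule finite_subset)
        show "{j \<in> J. t j \<noteq> \<zero>\<^bsub>M\<^esub>} \<subseteq> \<iota> ` {i \<in> I. s b i \<noteq> \<zero>\<^bsub>M\<^esub>}"
          using t_\<iota> I' by (auto simp: J_def)
        show "finite (\<iota> ` {i \<in> I. s b i \<noteq> \<zero>\<^bsub>M\<^esub>})"
          using s(1)[OF b] by (simp add: copower_def)
      qed
      ultimately have "t \<in> carrier (copower M J)"
        by (simp add: copower_def)
      moreover have "ext t = s b"
      proof
        fix i
        have "s b i = undefined" if "i \<notin> I"
          using s(1)[OF b] that by (auto simp: copower_def)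
        moreover have "s b i = \<zero>\<^bsub>M\<^esub>" if "i \<in> I" "i \<notin> I'"
          using that b by (auto simp: I'_def S_def)
        ultimately show "ext t i = s b i"
          using t_\<iota> by (simp add: ext_def)
      qed
      ultimately show "c b \<in> (\<lambda>t. h (ext t)) ` carrier (copower M J)"
        using s(2)[OF b] by (metis image_eqI)
    qed
  qed
qed

lemma M_generatedI:
  fixes M :: "('r, 'm, 'c) module_scheme" and N :: "('r, 'n, 'd) module_scheme" and I :: "'i set"
  assumes "left_module R M" "left_module R N"
    and "h \<in> lmod_hom R (copower M I) N" "h ` carrier (copower M I) = carrier N"
  shows "M_generated R M N"
proof -
  obtain J :: "('n \<times> nat) set" and h' where h': "h' \<in> lmod_hom R (copower M J) N"
      "h' ` carrier (copower M J) \<subseteq> h ` carrier (copower M I)"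
      "(\<lambda>n. n) ` carrier N \<subseteq> h' ` carrier (copower M J)"
    by (rule copower_reindex[OF assms(1,3), of "carrier N" "\<lambda>n. n"]) (auto simp: assms(4))
  show ?thesis
    unfolding M_generated_def
    by (intro conjI exI[of _ J] bexI[of _ h'] assms h') (use h' assms(4) in auto)
qed

text \<open>Transport of a module structure along a map that is injective on the carrier.\<close>

definition transport :: "('x \<Rightarrow> 'y) \<Rightarrow> ('r, 'x, 'c) module_scheme \<Rightarrow> ('r, 'y) module"
  where "transport q X = (let r = inv_into (carrier X) q in
    \<lparr>carrier = q ` carrier X, mult = undefined, one = undefined,
     zero = q \<zero>\<^bsub>X\<^esub>, add = (\<lambda>u v. q (r u \<oplus>\<^bsub>X\<^esub> r v)), smult = (\<lambda>a u. q (a \<odot>\<^bsub>X\<^esub> r u))\<rparr>)"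

lemma transport:
  assumes X: "left_module R X" and inj: "inj_on q (carrier X)"
  shows "left_module R (transport q X)"
    and "carrier (transport q X) = q ` carrier X"
    and "q \<in> lmod_hom R X (transport q X)"
    and "inv_into (carrier X) q \<in> lmod_hom R (transport q X) X"
proof -
  interpret left_module R X by fact
  show car: "carrier (transport q X) = q ` carrier X"
    by (simp add: transport_def Let_def)
  have r: "inv_into (carrier X) q (q x) = x" if "x \<in> carrier X" for x
    using that inj by simp
  have add: "q x \<oplus>\<^bsub>transport q X\<^esub> q y = q (x \<oplus>\<^bsub>X\<^esub> y)" if "x \<in> carrier X" "y \<in> carrier X" for x y
    using that r by (simp add: transport_def Let_def)
  have smult: "a \<odot>\<^bsub>transport q X\<^esub> q x = q (a \<odot>\<^bsub>X\<^esub> x)" if "x \<in> carrier X" for a x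
    using that r by (simp add: transport_def Let_def)
  have zero: "\<zero>\<^bsub>transport q X\<^esub> = q \<zero>\<^bsub>X\<^esub>"
    by (simp add: transport_def Let_def)
  have inv: "\<exists>y\<in>q ` carrier X. y \<oplus>\<^bsub>transport q X\<^esub> q x = \<zero>\<^bsub>transport q X\<^esub>" if "x \<in> carrier X" for x
    using that by (intro bexI[of _ "q (\<ominus>\<^bsub>X\<^esub> x)"]) (auto simp: add zero M.l_neg M.r_neg)
  show "left_module R (transport q X)"
  proof (rule left_moduleI)
    show "\<exists>y\<in>carrier (transport q X). y \<oplus>\<^bsub>transport q X\<^esub> u = \<zero>\<^bsub>transport q X\<^esub>"
      if "u \<in> carrier (transport q X)" for u
      using that inv by (auto simp: car)
  qed (auto simp: car add smult zero M.a_ac smult_l_distr smult_r_distr smult_assoc1 R.ring_axioms)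
  show "q \<in> lmod_hom R X (transport q X)"
    by (rule lmod_homI) (auto simp: car add smult)
  show "inv_into (carrier X) q \<in> lmod_hom R (transport q X) X"
    by (rule lmod_homI) (auto simp: car add smult r)
qed

lemma in_sigmaI:
  fixes M :: "('r, 'm, 'c) module_scheme" and X :: "('r, 'x, 'd) module_scheme"
    and N :: "('r, 'n, 'f) module_scheme"
  assumes M: "left_module R M" and X: "left_module R X"
    and N: "M_generated R M N" and e: "e \<in> lmod_hom R X N" and inj: "inj_on e (carrier X)"
  shows "in_sigma R M X"
proof -
  have lN: "left_module R N"
    using N by (simp add: M_generated_def)
  obtain I :: "('n \<times> nat) set" and h where h: "h \<in> lmod_hom R (copower M I) N"
      "h ` carrier (copower M I) = carrier N"
    using N unfolding M_generated_def by blast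
  obtain J :: "('x \<times> nat) set" and h' where h': "h' \<in> lmod_hom R (copower M J) N"
      "h' ` carrier (copower M J) \<subseteq> h ` carrier (copower M I)"
      "e ` carrier X \<subseteq> h' ` carrier (copower M J)"
    by (rule copower_reindex[OF M h(1), of "carrier X" e]) (use h(2) lmod_homD(1)[OF e] in auto)
  define H where "H = h' ` carrier (copower M J)"
  have H: "submodule H R N"
    unfolding H_def by (rule submodule_image[OF left_module_copower[OF M] lN h'(1)])
  define N' where "N' = N\<lparr>carrier := H\<rparr>"
  have N': "left_module R N'"
    unfolding N'_def by (rule left_module_submodule[OF lN H])
  have h'N': "h' \<in> lmod_hom R (copower M J) N'"
    by (rule lmod_homI) (auto simp: N'_def H_def lmod_homD[OF h'(1)])
  have eN': "e \<in> lmod_hom R X N'"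
    using h'(3) by (intro lmod_homI) (auto simp: N'_def H_def lmod_homD[OF e])
  define q where "q n = {s \<in> carrier (copower M J). h' s = n}" for n
  have q: "inj_on q (carrier N')"
    by (rule inj_onI) (auto simp: N'_def H_def q_def)
  note T = transport[OF N' q]
  have "M_generated R M (transport q N')"
  proof (rule M_generatedI[OF M T(1) lmod_hom_comp[OF h'N' T(3)]])
    show "(\<lambda>x. q (h' x)) ` carrier (copower M J) = carrier (transport q N')"
      unfolding T(2) by (auto simp: N'_def H_def)
  qed
  moreover have "(\<lambda>x. q (e x)) \<in> lmod_hom R X (transport q N')"
    by (rule lmod_hom_comp[OF eN' T(3)])
  moreover have "inj_on (\<lambda>x. q (e x)) (carrier X)"
    using inj q lmod_homD(1)[OF eN'] by (auto simp: inj_on_def)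
  ultimately show ?thesis
    unfolding in_sigma_def using X by blast
qed

lemma in_sigma_embed:
  assumes "left_module R M" "in_sigma R M Y" "left_module R X"
    and "e \<in> lmod_hom R X Y" "inj_on e (carrier X)"
  shows "in_sigma R M X"
proof -
  obtain N :: "('a, ('e \<times> nat \<Rightarrow> 'c) set) module" and d where
    d: "M_generated R M N" "d \<in> lmod_hom R Y N" "inj_on d (carrier Y)"
    using assms(2) by (auto simp: in_sigma_def)
  have "inj_on (\<lambda>x. d (e x)) (carrier X)"
    using assms(5) d(3) lmod_homD(1)[OF assms(4)] by (auto simp: inj_on_def)
  then show ?thesis
    by (rule in_sigmaI[OF assms(1,3) d(1) lmod_hom_comp[OF assms(4) d(2)]])
qed

theorem projective_in_sigma_lift:
  fixes M :: "('r, 'm, 'c) module_scheme"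
    and X :: "('r, 'x, 'd) module_scheme" and Y :: "('r, 'y, 'f) module_scheme"
  assumes M: "left_module R M" and proj: "projective_in_sigma R M"
    and X: "in_sigma R M X" and Y: "in_sigma R M Y"
    and g: "g \<in> lmod_hom R X Y" "g ` carrier X = carrier Y"
    and f: "f \<in> lmod_hom R M Y"
  shows "\<exists>h \<in> lmod_hom R M X. \<forall>m \<in> carrier M. g (h m) = f m"
proof -
  have lX: "left_module R X" and lY: "left_module R Y"
    using X Y unfolding in_sigma_def by blast+
  obtain N :: "('r, ('x \<times> nat \<Rightarrow> 'm) set) module" and e where
    N: "M_generated R M N" and e: "e \<in> lmod_hom R X N" "inj_on e (carrier X)"
    using X unfolding in_sigma_def by blast
  have lN: "left_module R N"
    using N by (simp add: M_generated_def)
  obtain I :: "(('x \<times> nat \<Rightarrow> 'm) set \<times> nat) set" and h where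
    h: "h \<in> lmod_hom R (copower M I) N" "h ` carrier (copower M I) = carrier N"
    using N unfolding M_generated_def by blast
  have "\<forall>m\<in>carrier M. \<exists>x. x \<in> carrier X \<and> g x = f m"
    using g(2) lmod_homD(1)[OF f] by (metis imageE)
  then obtain x where x: "\<And>m. m \<in> carrier M \<Longrightarrow> x m \<in> carrier X"
      "\<And>m. m \<in> carrier M \<Longrightarrow> g (x m) = f m"
    by metis
  obtain J :: "('m \<times> nat) set" and h' where h': "h' \<in> lmod_hom R (copower M J) N"
      "(\<lambda>m. e (x m)) ` carrier M \<subseteq> h' ` carrier (copower M J)"
    by (rule copower_reindex[OF M h(1), of "carrier M" "\<lambda>m. e (x m)"])
       (use h(2) lmod_homD(1)[OF e(1)] x in auto)
  interpret X: left_module R X by fact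
  interpret Y: left_module R Y by fact
  interpret N: left_module R N by fact
  define H where "H = h' ` carrier (copower M J)"
  have "submodule H R N"
    unfolding H_def by (rule submodule_image[OF left_module_copower[OF M] lN h'(1)])
  note H = N.submoduleD[OF this]
  define A where "A = {x \<in> carrier X. e x \<in> H}"
  have A: "submodule A R X"
    by (rule X.submoduleI)
       (auto simp: A_def lmod_homD[OF e(1)] lmod_hom_zero[OF lX lN e(1)] H(2-4))
  define X' where "X' = X\<lparr>carrier := A\<rparr>"
  have lX': "left_module R X'"
    unfolding X'_def by (rule left_module_submodule[OF lX A])
  have AX: "A \<subseteq> carrier X"
    by (auto simp: A_def)
  have gX': "g \<in> lmod_hom R X' Y"
    using AX by (intro lmod_homI) (auto simp: X'_def lmod_homD[OF g(1)] subset_iff)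
  define Y' where "Y' = Y\<lparr>carrier := g ` A\<rparr>"
  have "submodule (g ` A) R Y"
    using submodule_image[OF lX' lY gX'] by (simp add: X'_def)
  then have lY': "left_module R Y'"
    unfolding Y'_def by (rule left_module_submodule[OF lY])
  have gXY: "g \<in> lmod_hom R X' Y'"
    by (rule lmod_homI) (use lmod_homD[OF gX'] in \<open>auto simp: X'_def Y'_def\<close>)
  have xA: "x m \<in> A" if "m \<in> carrier M" for m
    using that x h'(2) by (auto simp: A_def H_def)
  have fY': "f \<in> lmod_hom R M Y'"
  proof (rule lmod_homI)
    show "f m \<in> carrier Y'" if "m \<in> carrier M" for m
      using xA[OF that] x(2)[OF that] by (auto simp: Y'_def intro: rev_image_eqI)
  qed (auto simp: Y'_def lmod_homD[OF f])
  define p where "p z = {s \<in> carrier (copower M J). h' s = e z}" for z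
  have p: "inj_on p (carrier X')"
  proof (rule inj_onI)
    fix z w assume zw: "z \<in> carrier X'" "w \<in> carrier X'" "p z = p w"
    obtain s where s: "s \<in> carrier (copower M J)" "h' s = e z"
      using zw(1) by (auto simp: X'_def A_def H_def)
    then have "s \<in> p w"
      using zw(3) by (auto simp: p_def)
    then have "e z = e w"
      using s(2) by (auto simp: p_def)
    then show "z = w"
      using e(2) zw(1,2) by (auto simp: X'_def A_def inj_on_def)
  qed
  define q where "q y = (\<Union>z \<in> {z \<in> A. g z = y}. p z)" for y
  have q: "inj_on q (carrier Y')"
  proof (rule inj_onI)
    fix y w assume yw: "y \<in> carrier Y'" "w \<in> carrier Y'" "q y = q w"
    obtain z where z: "z \<in> A" "g z = y"
      using yw(1) by (auto simp: Y'_def)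
    then obtain s where s: "s \<in> p z"
      by (auto simp: A_def H_def p_def)
    then have "s \<in> q w"
      using yw(3) z by (auto simp: q_def)
    then obtain z' where z': "z' \<in> A" "g z' = w" "s \<in> p z'"
      by (auto simp: q_def)
    have "e z = e z'"
      using s z'(3) by (auto simp: p_def)
    then have "z = z'"
      using e(2) z z'(1) by (auto simp: A_def inj_on_def)
    then show "y = w"
      using z z' by simp
  qed
  note TX = transport[OF lX' p] and TY = transport[OF lY' q]
  define r where "r = inv_into (carrier X') p"
  have rp: "r (p z) = z" if "z \<in> carrier X'" for z
    unfolding r_def using p that by simp
  have rX: "r \<in> lmod_hom R (transport p X') X"
    using lmod_homD[OF TX(4)] AX
    by (intro lmod_homI) (auto simp: r_def X'_def subset_iff)
  have sX: "in_sigma R M (transport p X')"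
    by (rule in_sigma_embed[OF M X TX(1) rX]) (auto simp: TX(2) inj_on_def rp)
  have rqY: "inv_into (carrier Y') q \<in> lmod_hom R (transport q Y') Y"
  proof (rule lmod_homI)
    show "inv_into (carrier Y') q u \<in> carrier Y" if "u \<in> carrier (transport q Y')" for u
      using lmod_homD(1)[OF TY(4) that] lmod_homD(1)[OF g(1)] AX by (auto simp: Y'_def)
  qed (simp_all add: lmod_homD[OF TY(4)], simp_all add: Y'_def)
  have sY: "in_sigma R M (transport q Y')"
    by (rule in_sigma_embed[OF M Y TY(1) rqY]) (use q in \<open>auto simp: TY(2) inj_on_def\<close>)
  have g': "(\<lambda>u. q (g (r u))) \<in> lmod_hom R (transport p X') (transport q Y')"
    using lmod_hom_comp[OF lmod_hom_comp[OF TX(4) gXY] TY(3)] by (simp add: r_def)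
  have g's: "(\<lambda>u. q (g (r u))) ` carrier (transport p X') = carrier (transport q Y')"
    by (simp add: TX(2) TY(2) image_image rp cong: image_cong) (simp add: X'_def Y'_def image_image)
  obtain k where k: "k \<in> lmod_hom R M (transport p X')"
      "\<And>m. m \<in> carrier M \<Longrightarrow> q (g (r (k m))) = q (f m)"
    using proj[unfolded projective_in_sigma_def, rule_format, OF sX sY g' g's
        lmod_hom_comp[OF fY' TY(3)]] by blast
  show ?thesis
  proof (rule bexI, rule ballI)
    show "(\<lambda>m. r (k m)) \<in> lmod_hom R M X"
      by (rule lmod_hom_comp[OF k(1) rX])
    fix m assume m: "m \<in> carrier M"
    have "g (r (k m)) \<in> carrier Y'"
      using lmod_homD(1)[OF lmod_hom_comp[OF k(1) TX(4)] m] lmod_homD(1)[OF gXY]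
      by (auto simp: r_def)
    then show "g (r (k m)) = f m"
      using k(2)[OF m] q lmod_homD(1)[OF fY' m] by (auto simp: inj_on_def)
  qed
qed


section \<open>The sets \<open>U(N)\<close> form a topology\<close>

lemma fully_invariant_Int:
  assumes "left_module R M" "L \<in> fully_invariant R M" "K \<in> fully_invariant R M"
  shows "L \<inter> K \<in> fully_invariant R M"
proof -
  interpret left_module R M by fact
  have sub: "submodule L R M" "submodule K R M"
    using assms by (auto simp: fully_invariant_def)
  have "submodule (L \<inter> K) R M"
    using submoduleD[OF sub(1)] submoduleD[OF sub(2)] by (intro submoduleI) auto
  then show ?thesis
    using assms(2,3) unfolding fully_invariant_def by blast
qed

lemma module_prod_subset:
  assumes "left_module R M" "L \<in> fully_invariant R M" "K \<in> fully_invariant R M"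
  shows "module_prod R M L (M\<lparr>carrier := K\<rparr>) \<subseteq> L \<inter> K"
proof -
  interpret left_module R M by fact
  have LK: "submodule (L \<inter> K) R M" and subK: "submodule K R M" and subL: "submodule L R M"
    using fully_invariant_Int[OF assms] assms by (auto simp: fully_invariant_def)
  interpret K: left_module R "M\<lparr>carrier := K\<rparr>"
    by (rule left_module_submodule[OF assms(1) subK])
  have img: "f ` L \<subseteq> L \<inter> K" if f: "f \<in> lmod_hom R M (M\<lparr>carrier := K\<rparr>)" for f
  proof -
    have "f \<in> lmod_hom R M M"
      using lmod_homD[OF f] submoduleD(1)[OF subK] by (intro lmod_homI) auto
    then show ?thesis
      using assms(2) lmod_homD(1)[OF f] submoduleD(1)[OF subL] by (auto simp: fully_invariant_def)
  qed
  have sum: "finsum (M\<lparr>carrier := K\<rparr>) x A \<in> L \<inter> K" if "finite A" "\<forall>S\<in>A. x S \<in> L \<inter> K" for x A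
    using that
  proof (induction A)
    case empty
    then show ?case using submoduleD(2)[OF LK] by simp
  next
    case (insert S A)
    then have "finsum (M\<lparr>carrier := K\<rparr>) x (insert S A) = x S \<oplus>\<^bsub>M\<^esub> finsum (M\<lparr>carrier := K\<rparr>) x A"
      by (subst K.M.finsum_insert) auto
    then show ?case
      using insert submoduleD(3)[OF LK] by auto
  qed
  show ?thesis
  proof
    fix z assume "z \<in> module_prod R M L (M\<lparr>carrier := K\<rparr>)"
    then obtain x A where z: "z = finsum (M\<lparr>carrier := K\<rparr>) x A" "finite A"
        "A \<subseteq> {f ` L | f. f \<in> lmod_hom R M (M\<lparr>carrier := K\<rparr>)}" "\<forall>S\<in>A. x S \<in> S"
      unfolding module_prod_def submodule_sum_def by blast
    then have "\<forall>S\<in>A. x S \<in> L \<inter> K"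
      using img by blast
    then show "z \<in> L \<inter> K"
      using sum z(1,2) by blast
  qed
qed

lemma istopology_Spec:
  assumes "left_module R M"
  shows "istopology (\<lambda>W. \<exists>N \<in> fully_invariant R M. W = Spec_open R M N)"
  unfolding istopology_def
proof (intro conjI allI impI)
  interpret left_module R M by fact
  fix S T
  assume "\<exists>N\<in>fully_invariant R M. S = Spec_open R M N"
    and "\<exists>N\<in>fully_invariant R M. T = Spec_open R M N"
  then obtain L K where LK: "L \<in> fully_invariant R M" "S = Spec_open R M L"
      "K \<in> fully_invariant R M" "T = Spec_open R M K"
    by auto
  have "S \<inter> T = Spec_open R M (L \<inter> K)"
  proof
    show "S \<inter> T \<subseteq> Spec_open R M (L \<inter> K)"
      using LK module_prod_subset[OF assms LK(1,3)] unfolding Spec_open_def Spec_def by blast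
  qed (auto simp: LK Spec_open_def)
  then show "\<exists>N\<in>fully_invariant R M. S \<inter> T = Spec_open R M N"
    using fully_invariant_Int[OF assms LK(1,3)] by blast
next
  interpret left_module R M by fact
  fix \<K> assume \<K>: "\<forall>W\<in>\<K>. \<exists>N\<in>fully_invariant R M. W = Spec_open R M N"
  define F where "F = {N \<in> fully_invariant R M. Spec_open R M N \<in> \<K>}"
  define N where "N = carrier M \<inter> \<Inter>{L \<in> fully_invariant R M. \<Union>F \<subseteq> L}"
  have "submodule N R M"
    unfolding N_def fully_invariant_def
    by (rule submoduleI) (auto dest: submoduleD)
  moreover have "f ` N \<subseteq> N" if "f \<in> lmod_hom R M M" for f
    using that lmod_homD(1)[OF that] unfolding N_def fully_invariant_def by blast
  ultimately have N: "N \<in> fully_invariant R M"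
    by (auto simp: fully_invariant_def)
  have "N \<subseteq> P \<longleftrightarrow> (\<forall>L\<in>F. L \<subseteq> P)" if "P \<in> Spec R M" for P
  proof
    assume "N \<subseteq> P"
    moreover have "\<Union>F \<subseteq> N"
      by (auto simp: N_def F_def fully_invariant_def dest: submoduleD(1))
    ultimately show "\<forall>L\<in>F. L \<subseteq> P" by blast
  next
    assume "\<forall>L\<in>F. L \<subseteq> P"
    then show "N \<subseteq> P"
      using that unfolding N_def Spec_def by blast
  qed
  then have "Spec_open R M N = (\<Union>L\<in>F. Spec_open R M L)"
    unfolding Spec_open_def by blast
  moreover have "\<K> = Spec_open R M ` F"
  proof (intro equalityI subsetI)
    fix W assume W: "W \<in> \<K>"
    then obtain L where "L \<in> fully_invariant R M" "W = Spec_open R M L"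
      using \<K> by metis
    then show "W \<in> Spec_open R M ` F"
      using W by (intro image_eqI[of _ _ L]) (simp_all add: F_def)
  next
    fix W assume "W \<in> Spec_open R M ` F"
    then show "W \<in> \<K>"
      by (elim imageE) (simp add: F_def)
  qed
  ultimately have "\<Union>\<K> = Spec_open R M N"
    by simp
  then show "\<exists>N\<in>fully_invariant R M. \<Union>\<K> = Spec_open R M N"
    using N by blast
qed

lemma openin_Spec_topology:
  assumes "left_module R M"
  shows "openin (Spec_topology R M) W \<longleftrightarrow> (\<exists>N \<in> fully_invariant R M. W = Spec_open R M N)"
  using istopology_Spec[OF assms] by (simp add: Spec_topology_def topology_inverse')

lemma topspace_Spec_topology:
  assumes "left_module R M"
  shows "topspace (Spec_topology R M) = Spec R M"
proof -
  interpret left_module R M by fact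
  have "submodule (carrier M) R M"
    by (rule submoduleI) auto
  then have "carrier M \<in> fully_invariant R M"
    using lmod_homD(1) by (fastforce simp: fully_invariant_def)
  moreover have "Spec_open R M (carrier M) = Spec R M"
    by (auto simp: Spec_open_def Spec_def fully_invariant_def dest: submoduleD(1))
  ultimately have "openin (Spec_topology R M) (Spec R M)"
    using openin_Spec_topology[OF assms] by metis
  moreover have "W \<subseteq> Spec R M" if "openin (Spec_topology R M) W" for W
    using that openin_Spec_topology[OF assms] by (auto simp: Spec_open_def)
  ultimately show ?thesis
    by (simp add: openin_subset subset_antisym)
qed

end

theory Submission
  imports Defs
begin

text \<open>The generic point of a closed irreducible set \<open>X\<close> is the intersection \<open>P\<close> of its members:
  if neither \<open>L\<close> nor \<open>K\<close> is contained in \<open>P\<close>, irreducibility yields one \<open>Q \<in> X\<close> containing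
  neither, and as \<open>Q\<close> is prime the product of \<open>L\<close> and \<open>K\<close> is not contained in \<open>Q\<close>, hence not
  in \<open>P\<close>.\<close>

text \<open>The empty family is excluded because \<open>\<Inter>{}\<close> is the whole type; any
  one member keeps the intersection inside \<open>carrier M\<close>.\<close>

lemma fully_invariant_Inter:
  assumes "left_module R M" "F \<noteq> {}" "F \<subseteq> fully_invariant R M"
  shows "\<Inter>F \<in> fully_invariant R M"
proof -
  interpret left_module R M by fact
  have sub: "submodule N R M" if "N \<in> F" for N
    using assms(3) that by (auto simp: fully_invariant_def)
  have "submodule (\<Inter>F) R M"
  proof (rule submoduleI)
    show "\<Inter>F \<subseteq> carrier M"
      using assms(2) submoduleD(1)[OF sub] by blast
  qed (auto intro: submoduleD(2-4)[OF sub])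
  moreover have "f ` \<Inter>F \<subseteq> \<Inter>F" if "f \<in> lmod_hom R M M" for f
    using assms(3) that unfolding fully_invariant_def by blast
  ultimately show ?thesis
    by (simp add: fully_invariant_def)
qed

text \<open>Among the basic sets \<open>Spec_open R M N\<close>, those missing \<open>P\<close> are
  the ones with \<open>N \<subseteq> P\<close>. The largest is \<open>Spec_open R M P\<close>, so
  the closure is its complement.\<close>

lemma closure_of_Spec_singleton:
  assumes "left_module R M" "P \<in> Spec R M"
  shows "Abstract_Topology.closure_of (Spec_topology R M) {P} = {Q \<in> Spec R M. P \<subseteq> Q}"
proof -
  have P: "P \<in> fully_invariant R M"
    using assms(2) by (simp add: Spec_def)
  have "(\<forall>T. Q \<in> T \<and> openin (Spec_topology R M) T \<longrightarrow> P \<in> T) \<longleftrightarrow> P \<subseteq> Q"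
    if "Q \<in> Spec R M" for Q
  proof
    assume T: "\<forall>T. Q \<in> T \<and> openin (Spec_topology R M) T \<longrightarrow> P \<in> T"
    have "openin (Spec_topology R M) (Spec_open R M P)"
      using P openin_Spec_topology[OF assms(1)] by blast
    moreover have "P \<notin> Spec_open R M P"
      by (simp add: Spec_open_def)
    ultimately have "Q \<notin> Spec_open R M P"
      using T by blast
    then show "P \<subseteq> Q"
      using that by (simp add: Spec_open_def)
  next
    assume "P \<subseteq> Q"
    then show "\<forall>T. Q \<in> T \<and> openin (Spec_topology R M) T \<longrightarrow> P \<in> T"
      using assms(2) openin_Spec_topology[OF assms(1)] by (auto simp: Spec_open_def)
  qed
  then show ?thesis
    by (simp add: closure_of_def topspace_Spec_topology[OF assms(1)] cong: conj_cong)
qed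

lemma closedin_Spec_topology:
  assumes "left_module R M"
  shows "closedin (Spec_topology R M) X \<longleftrightarrow>
    (\<exists>N \<in> fully_invariant R M. X = Spec R M - Spec_open R M N)"
proof -
  \<comment> \<open>Complementation inside \<open>S\<close> is an involution, which lets a closed
    set be named by the \<open>N\<close> of its open complement.\<close>
  have "X \<subseteq> S \<and> S - X = T \<longleftrightarrow> X = S - T" if "T \<subseteq> S" for S T
    using that by (metis Diff_subset double_diff order_refl)
  moreover have "Spec_open R M N \<subseteq> Spec R M" for N
    by (simp add: Spec_open_def)
  ultimately show ?thesis
    unfolding closedin_def topspace_Spec_topology[OF assms] openin_Spec_topology[OF assms]
    by metis
qed

lemma Inter_closed_irreducible_in_Spec:
  assumes "left_module R M" "closed_irreducible (Spec_topology R M) X"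
  shows "\<Inter>X \<in> Spec R M"
proof -
  have X: "X \<subseteq> Spec R M" "X \<noteq> {}"
    using assms(2) closedin_Spec_topology[OF assms(1)] unfolding closed_irreducible_def by blast+
  have fi: "\<Inter>X \<in> fully_invariant R M"
    using X by (intro fully_invariant_Inter[OF assms(1)]) (auto simp: Spec_def)
  \<comment> \<open>One member suffices: it is proper and contains the intersection.\<close>
  have proper: "\<Inter>X \<noteq> carrier M"
  proof -
    obtain Q where Q: "Q \<in> X" using X(2) by blast
    then have "Q \<subseteq> carrier M" "Q \<noteq> carrier M"
      using X(1) left_module.submoduleD(1)[OF assms(1)]
      by (auto simp: Spec_def fully_invariant_def)
    then show ?thesis using Q by blast
  qed
  have "L \<subseteq> \<Inter>X \<or> K \<subseteq> \<Inter>X"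
    if LK: "L \<in> fully_invariant R M" "K \<in> fully_invariant R M"
      and prod: "module_prod R M L (M\<lparr>carrier := K\<rparr>) \<subseteq> \<Inter>X" for L K
  proof (rule ccontr)
    assume "\<not> ?thesis"
    \<comment> \<open>Failing to lie in \<open>\<Inter>X\<close> means failing to lie in some member
      of \<open>X\<close>, that is, \<open>X\<close> meets the corresponding open set.\<close>
    then have "X \<inter> Spec_open R M L \<noteq> {}" "X \<inter> Spec_open R M K \<noteq> {}"
      using X(1) unfolding Spec_open_def by blast+
    moreover have "openin (Spec_topology R M) (Spec_open R M L)"
        "openin (Spec_topology R M) (Spec_open R M K)"
      using LK openin_Spec_topology[OF assms(1)] by blast+
    ultimately have "X \<inter> Spec_open R M L \<inter> Spec_open R M K \<noteq> {}"
      using assms(2) unfolding closed_irreducible_def by blast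
    then obtain Q where "Q \<in> X" "Q \<in> Spec R M" "\<not> L \<subseteq> Q" "\<not> K \<subseteq> Q"
      unfolding Spec_open_def by blast
    then show False
      using LK prod unfolding Spec_def by blast
  qed
  then show ?thesis
    using fi proper unfolding Spec_def by blast
qed

theorem proposition4p5:
  fixes R :: "('r, 'e) ring_scheme" and M :: "('r, 'm, 'c) module_scheme"
  assumes "ring R"
    and "left_module R M"
    and "projective_in_sigma R M"
  shows "sober_space (Spec_topology R M)"
  unfolding sober_space_def topspace_Spec_topology[OF assms(2)]
proof (intro allI impI)
  fix X assume X: "closed_irreducible (Spec_topology R M) X"
  have "closedin (Spec_topology R M) X"
    using X by (simp add: closed_irreducible_def)
  then obtain N where N: "X = Spec R M - Spec_open R M N"
    unfolding closedin_Spec_topology[OF assms(2)] by (elim bexE)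
  have P: "\<Inter>X \<in> Spec R M"
    by (rule Inter_closed_irreducible_in_Spec[OF assms(2) X])
  show "\<exists>!P. P \<in> Spec R M \<and> X = Abstract_Topology.closure_of (Spec_topology R M) {P}"
  proof (rule ex1I[of _ "\<Inter>X"])
    have "X = {Q \<in> Spec R M. \<Inter>X \<subseteq> Q}"
    proof (intro equalityI subsetI)
      fix Q assume "Q \<in> X"
      moreover from this have "Q \<in> Spec R M"
        by (simp add: N)
      ultimately show "Q \<in> {Q \<in> Spec R M. \<Inter>X \<subseteq> Q}"
        by (simp add: Inter_lower)
    next
      fix Q assume Q: "Q \<in> {Q \<in> Spec R M. \<Inter>X \<subseteq> Q}"
      \<comment> \<open>\<open>X\<close> consists of the primes containing \<open>N\<close>, so
        \<open>N\<close> lies below their intersection, and every prime above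
        \<open>\<Inter>X\<close> contains \<open>N\<close> as well.\<close>
      have "N \<subseteq> \<Inter>X"
        by (intro Inter_greatest) (simp add: N Spec_open_def)
      then have "N \<subseteq> Q"
        using Q by blast
      then show "Q \<in> X"
        using Q by (simp add: N Spec_open_def)
    qed
    then show "\<Inter>X \<in> Spec R M \<and> X = Abstract_Topology.closure_of (Spec_topology R M) {\<Inter>X}"
      using closure_of_Spec_singleton[OF assms(2) P] P by simp
  next
    fix Q assume "Q \<in> Spec R M \<and> X = Abstract_Topology.closure_of (Spec_topology R M) {Q}"
    \<comment> \<open>Any generic point is the least element of \<open>X\<close> under inclusion,
      and a least element equals the intersection.\<close>
    then have "Q \<in> X" "\<And>Q'. Q' \<in> X \<Longrightarrow> Q \<subseteq> Q'"
      using closure_of_Spec_singleton[OF assms(2), of Q] by simp_all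
    then show "Q = \<Inter>X"
      by (intro equalityI Inter_greatest Inter_lower)
  qed
qed

end
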